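(* Let $\Delta\equiv\lambda x.xx$. The $\lambda$-theory $\mathcal{J}$ axiomatized (over $\beta$-conversion) by the equations $$\Delta\Delta xx = x;\qquad \Delta\Delta xy=\Delta\Delta yx;\qquad \Delta\Delta x(\Delta\Delta yz)=\Delta\Delta(\Delta\Delta xy)z,$$ where $x,y,z$ are variables, is consistent (i.e., it does not equate all $\lambda$-terms).
   Context: A $\lambda$-theory is a congruence on (untyped) $\lambda$-terms, closed under the relevant term-formation rules, that contains $\beta$-conversion; the theory axiomatized by a set of equations is the least such theory containing them. It is consistent if it does not identify all terms. *)

theory Defs
  imports Main
begin

text \<open>Untyped \<open>\<lambda>\<close>-terms up to \<open>\<alpha>\<close>-conversion, in de Bruijn notation: \<open>Var n\<close> refers to the
  binder that is \<open>n\<close> levels up, and to a free variable if there is no such binder.\<close>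

datatype lam =
    Var nat
  | App lam lam  (infixl \<open>\<degree>\<close> 200)
  | Lam lam

primrec lift :: "nat \<Rightarrow> lam \<Rightarrow> lam" where
  "lift k (Var i) = (if i < k then Var i else Var (Suc i))"
| "lift k (s \<degree> t) = lift k s \<degree> lift k t"
| "lift k (Lam s) = Lam (lift (Suc k) s)"

text \<open>\<open>lsubst k s t\<close> replaces the index \<open>k\<close> in \<open>t\<close> by \<open>s\<close>. As the binder to which \<open>k\<close> belongs is
  removed by a \<open>\<beta>\<close>-step, the larger indices are decreased by one.\<close>

primrec lsubst :: "nat \<Rightarrow> lam \<Rightarrow> lam \<Rightarrow> lam" where
  "lsubst k s (Var i) = (if i < k then Var i else if i = k then s else Var (i - 1))"
| "lsubst k s (t \<degree> u) = lsubst k s t \<degree> lsubst k s u"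
| "lsubst k s (Lam t) = Lam (lsubst (Suc k) (lift 0 s) t)"

definition lambda_theory :: "(lam \<times> lam) set \<Rightarrow> bool" where
  "lambda_theory T \<longleftrightarrow>
     equiv UNIV T \<and>
     (\<forall>M M' N N'. (M, M') \<in> T \<longrightarrow> (N, N') \<in> T \<longrightarrow> (M \<degree> N, M' \<degree> N') \<in> T) \<and>
     (\<forall>M M'. (M, M') \<in> T \<longrightarrow> (Lam M, Lam M') \<in> T) \<and>
     (\<forall>M N. (Lam M \<degree> N, lsubst 0 N M) \<in> T)"

definition theory_axiomatized_by :: "(lam \<times> lam) set \<Rightarrow> (lam \<times> lam) set" where
  "theory_axiomatized_by E = \<Inter> {T. lambda_theory T \<and> E \<subseteq> T}"

lemma lambda_theory_axiomatized: "lambda_theory (theory_axiomatized_by E)"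
proof -
  let ?C = "{T. lambda_theory T \<and> E \<subseteq> T}"
  have "equiv UNIV (\<Inter> ?C)"
  proof (rule equivI)
    show "refl (\<Inter> ?C)"
      by (rule refl_onI) (simp add: lambda_theory_def equiv_def refl_on_def)
    show "sym (\<Inter> ?C)"
    proof (rule symI, rule InterI)
      fix M N T assume "(M, N) \<in> \<Inter> ?C" "T \<in> ?C"
      then show "(N, M) \<in> T"
        by (metis InterD equiv_def lambda_theory_def mem_Collect_eq symD)
    qed
    show "trans (\<Inter> ?C)"
    proof (rule transI, rule InterI)
      fix M N P T assume "(M, N) \<in> \<Inter> ?C" "(N, P) \<in> \<Inter> ?C" "T \<in> ?C"
      then show "(M, P) \<in> T"
        by (metis InterD equiv_def lambda_theory_def mem_Collect_eq transD)
    qed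
  qed simp
  then show ?thesis
    unfolding theory_axiomatized_by_def lambda_theory_def[of "\<Inter> ?C"]
    by (simp add: lambda_theory_def)
qed

lemma axioms_subset_theory: "E \<subseteq> theory_axiomatized_by E"
  by (auto simp: theory_axiomatized_by_def)

lemma theory_axiomatized_by_least:
  "lambda_theory T \<Longrightarrow> E \<subseteq> T \<Longrightarrow> theory_axiomatized_by E \<subseteq> T"
  by (auto simp: theory_axiomatized_by_def)

definition consistent :: "(lam \<times> lam) set \<Rightarrow> bool" where
  "consistent T \<longleftrightarrow> (\<exists>M N. (M, N) \<notin> T)"

definition Delta :: lam  (\<open>\<Delta>\<close>) where
  "\<Delta> = Lam (Var 0 \<degree> Var 0)"

text \<open>The indices \<open>x\<close>, \<open>y\<close>, \<open>z\<close> range over all (free) variables. As a \<open>\<lambda>\<close>-theory is closed under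
  abstraction and contains \<open>\<beta>\<close>-conversion, the instances at three distinct variables already
  yield all others.\<close>

definition J_axioms :: "(lam \<times> lam) set" where
  "J_axioms =
     {(\<Delta> \<degree> \<Delta> \<degree> Var x \<degree> Var x, Var x) | x. True} \<union>
     {(\<Delta> \<degree> \<Delta> \<degree> Var x \<degree> Var y, \<Delta> \<degree> \<Delta> \<degree> Var y \<degree> Var x) | x y. True} \<union>
     {(\<Delta> \<degree> \<Delta> \<degree> Var x \<degree> (\<Delta> \<degree> \<Delta> \<degree> Var y \<degree> Var z),
       \<Delta> \<degree> \<Delta> \<degree> (\<Delta> \<degree> \<Delta> \<degree> Var x \<degree> Var y) \<degree> Var z) | x y z. True}"

definition J :: "(lam \<times> lam) set" where
  "J = theory_axiomatized_by J_axioms"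

end

theory Submission
  imports Defs "HOL-Library.FSet"
begin

text \<open>The proof constructs a graph-style model in the powerset of a set of points. Each point \<open>d\<close> is
  read as an arrow \<open>source d \<rightarrow> target d\<close> from a finite set of points to a point; for the soundness
  of \<open>\<beta>\<close>-conversion it suffices that every pair is represented, and no injectivity is needed.
  A point \<open>\<epsilon>\<close> with \<open>\<epsilon> = {\<epsilon>} \<rightarrow> \<alpha>\<close> forces \<open>\<alpha>\<close> into the denotation of \<open>\<Delta>\<Delta>\<close>, and by well-foundedness
  of the remaining arrows nothing else gets in. Adding such \<open>\<epsilon>\<close> exactly for the points
  \<open>{\<alpha>} \<rightarrow> {} \<rightarrow> \<alpha>\<close> and \<open>{} \<rightarrow> {\<alpha>} \<rightarrow> \<alpha>\<close> makes \<open>\<Delta>\<Delta>\<close> denote binary union, which is idempotent,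
  commutative and associative.\<close>

datatype point =
    Atom
  | Arr "point fset" point
  | EpsL point
  | EpsR point

definition keepL :: "point \<Rightarrow> point" where
  "keepL \<alpha> = Arr {|\<alpha>|} (Arr {||} \<alpha>)"

definition keepR :: "point \<Rightarrow> point" where
  "keepR \<alpha> = Arr {||} (Arr {|\<alpha>|} \<alpha>)"

text \<open>\<open>Atom\<close> acts as the arrow {} \<rightarrow> \<open>Atom\<close>; its empty
  source keeps it out of the denotation of \<open>\<Delta>\<close>.\<close>

fun source :: "point \<Rightarrow> point set" where
  "source Atom = {}"
| "source (Arr a \<alpha>) = fset a"
| "source (EpsL \<alpha>) = {EpsL \<alpha>}"
| "source (EpsR \<alpha>) = {EpsR \<alpha>}"

fun target :: "point \<Rightarrow> point" where
  "target Atom = Atom"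
| "target (Arr a \<alpha>) = \<alpha>"
| "target (EpsL \<alpha>) = keepL \<alpha>"
| "target (EpsR \<alpha>) = keepR \<alpha>"

lemma finite_source: "finite (source d)"
  by (cases d) auto

lemma arrow_exists:
  assumes "finite a"
  shows "\<exists>d. source d = a \<and> target d = \<alpha>"
  by (rule exI[of _ "Arr (Abs_fset a) \<alpha>"]) (simp add: assms Abs_fset_inverse)

definition apply_set :: "point set \<Rightarrow> point set \<Rightarrow> point set" where
  "apply_set u v = {target d | d. d \<in> u \<and> source d \<subseteq> v}"

primrec sem :: "lam \<Rightarrow> (nat \<Rightarrow> point set) \<Rightarrow> point set" where
  "sem (Var i) \<rho> = \<rho> i"
| "sem (M \<degree> N) \<rho> = apply_set (sem M \<rho>) (sem N \<rho>)"
| "sem (Lam M) \<rho> = {d. target d \<in> sem M (case_nat (source d) \<rho>)}"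

lemma sem_mono: "\<rho> \<le> \<sigma> \<Longrightarrow> sem M \<rho> \<subseteq> sem M \<sigma>"
proof (induction M arbitrary: \<rho> \<sigma>)
  case (Var i)
  then show ?case by (simp add: le_fun_def)
next
  case (App M N)
  from App.IH[OF App.prems] show ?case by (auto simp: apply_set_def)
next
  case (Lam M)
  have "case_nat (source d) \<rho> \<le> case_nat (source d) \<sigma>" for d
    using Lam.prems by (auto simp: le_fun_def split: nat.split)
  then show ?case using Lam.IH by fastforce
qed

lemma sem_lift: "sem (lift k M) \<rho> = sem M (\<lambda>i. \<rho> (if i < k then i else Suc i))"
proof (induction M arbitrary: k \<rho>)
  case (Lam M)
  have "(\<lambda>i. case_nat a \<rho> (if i < Suc k then i else Suc i)) =
      case_nat a (\<lambda>i. \<rho> (if i < k then i else Suc i))" for a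
    by (auto simp: fun_eq_iff split: nat.split)
  then show ?case by (simp add: Lam.IH)
qed auto

lemma sem_lsubst:
  "sem (lsubst k N M) \<rho> = sem M (\<lambda>i. if i < k then \<rho> i else if i = k then sem N \<rho> else \<rho> (i - 1))"
proof (induction M arbitrary: k N \<rho>)
  case (Lam M)
  have "(\<lambda>i. if i < Suc k then case_nat a \<rho> i else if i = Suc k then sem (lift 0 N) (case_nat a \<rho>)
        else case_nat a \<rho> (i - 1)) =
      case_nat a (\<lambda>i. if i < k then \<rho> i else if i = k then sem N \<rho> else \<rho> (i - 1))" for a
    by (auto simp: fun_eq_iff sem_lift split: nat.split)
  then show ?case by (simp add: Lam.IH)
qed auto

text \<open>Continuity: arrows have finite sources, so membership uses only finitely many points of
  each variable's value. This is what lets a single arrow represent the dependence on an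
  argument.\<close>

lemma sem_finitary: "d \<in> sem M \<rho> \<Longrightarrow> \<exists>\<sigma>. \<sigma> \<le> \<rho> \<and> (\<forall>i. finite (\<sigma> i)) \<and> d \<in> sem M \<sigma>"
proof (induction M arbitrary: \<rho> d)
  case (Var i)
  then show ?case by (intro exI[of _ "(\<lambda>_. {})(i := {d})"]) (auto simp: le_fun_def)
next
  case (App M N)
  then obtain e where e: "e \<in> sem M \<rho>" "source e \<subseteq> sem N \<rho>" "d = target e"
    by (auto simp: apply_set_def)
  obtain \<sigma> where \<sigma>: "\<sigma> \<le> \<rho>" "\<forall>i. finite (\<sigma> i)" "e \<in> sem M \<sigma>"
    using App.IH(1)[OF e(1)] by blast
  have "\<forall>c\<in>source e. \<exists>\<tau>. \<tau> \<le> \<rho> \<and> (\<forall>i. finite (\<tau> i)) \<and> c \<in> sem N \<tau>"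
    using App.IH(2) e(2) by blast
  then obtain \<tau> where
    \<tau>: "\<And>c. c \<in> source e \<Longrightarrow> \<tau> c \<le> \<rho> \<and> (\<forall>i. finite (\<tau> c i)) \<and> c \<in> sem N (\<tau> c)"
    by metis
  \<comment> \<open>As \<open>source e\<close> is finite, merging the environments of all its points
    keeps every value finite.\<close>
  define \<upsilon> where "\<upsilon> i = \<sigma> i \<union> (\<Union>c\<in>source e. \<tau> c i)" for i
  have "\<upsilon> \<le> \<rho>" using \<sigma>(1) \<tau> unfolding \<upsilon>_def le_fun_def by blast
  moreover have "finite (\<upsilon> i)" for i
    using \<sigma>(2) \<tau> finite_source by (auto simp: \<upsilon>_def)
  moreover have "e \<in> sem M \<upsilon>"
    using \<sigma>(3) sem_mono[of \<sigma> \<upsilon> M] by (auto simp: \<upsilon>_def le_fun_def)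
  moreover have "source e \<subseteq> sem N \<upsilon>"
  proof
    fix c assume c: "c \<in> source e"
    then have "\<tau> c \<le> \<upsilon>" by (auto simp: \<upsilon>_def le_fun_def)
    then show "c \<in> sem N \<upsilon>" using \<tau>[OF c] sem_mono by blast
  qed
  ultimately show ?case using e(3) by (auto simp: apply_set_def)
next
  case (Lam M)
  then obtain \<sigma> where \<sigma>: "\<sigma> \<le> case_nat (source d) \<rho>" "\<forall>i. finite (\<sigma> i)" "target d \<in> sem M \<sigma>"
    by fastforce
  \<comment> \<open>The bound variable may be raised back to \<open>source d\<close>; only the outer
    variables need finite approximations.\<close>
  have "\<sigma> i \<subseteq> case_nat (source d) (\<lambda>i. \<sigma> (Suc i)) i" for i
    using le_funD[OF \<sigma>(1), of i] by (cases i) auto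
  then have "target d \<in> sem M (case_nat (source d) (\<lambda>i. \<sigma> (Suc i)))"
    using \<sigma>(3) sem_mono[of \<sigma> "case_nat (source d) (\<lambda>i. \<sigma> (Suc i))" M] by (auto simp: le_fun_def)
  moreover have "(\<lambda>i. \<sigma> (Suc i)) \<le> \<rho>"
  proof (rule le_funI)
    fix i show "\<sigma> (Suc i) \<le> \<rho> i" using le_funD[OF \<sigma>(1), of "Suc i"] by simp
  qed
  ultimately show ?case using \<sigma>(2) by auto
qed

lemma sem_beta: "sem (Lam M \<degree> N) \<rho> = sem (lsubst 0 N M) \<rho>"
proof -
  let ?\<rho> = "case_nat (sem N \<rho>) \<rho>"
  have "sem (lsubst 0 N M) \<rho> = sem M ?\<rho>"
    unfolding sem_lsubst
    by (rule arg_cong[where f = "sem M"]) (auto simp: fun_eq_iff split: nat.split)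
  moreover have "sem (Lam M \<degree> N) \<rho> \<subseteq> sem M ?\<rho>"
  proof
    fix \<alpha> assume "\<alpha> \<in> sem (Lam M \<degree> N) \<rho>"
    then obtain d where d: "\<alpha> \<in> sem M (case_nat (source d) \<rho>)" "source d \<subseteq> sem N \<rho>"
      by (auto simp: apply_set_def)
    have "case_nat (source d) \<rho> \<le> ?\<rho>"
      using d(2) by (auto simp: le_fun_def split: nat.split)
    then show "\<alpha> \<in> sem M ?\<rho>" using d(1) sem_mono by blast
  qed
  moreover have "sem M ?\<rho> \<subseteq> sem (Lam M \<degree> N) \<rho>"
  proof
    fix \<alpha> assume "\<alpha> \<in> sem M ?\<rho>"
    then obtain \<sigma> where \<sigma>: "\<sigma> \<le> ?\<rho>" "\<forall>i. finite (\<sigma> i)" "\<alpha> \<in> sem M \<sigma>"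
      using sem_finitary by blast
    \<comment> \<open>The finite part of \<open>sem N \<rho>\<close> used to obtain
      \<open>\<alpha>\<close> becomes the source of an arrow.\<close>
    then obtain d where d: "source d = \<sigma> 0" "target d = \<alpha>"
      using arrow_exists by blast
    have "\<sigma> i \<subseteq> case_nat (source d) \<rho> i" for i
      using le_funD[OF \<sigma>(1), of i] d(1) by (cases i) auto
    then have "d \<in> sem (Lam M) \<rho>"
      using \<sigma>(3) d(2) sem_mono[of \<sigma> "case_nat (source d) \<rho>" M] by (auto simp: le_fun_def)
    moreover have "source d \<subseteq> sem N \<rho>" using le_funD[OF \<sigma>(1), of 0] d(1) by simp
    ultimately show "\<alpha> \<in> sem (Lam M \<degree> N) \<rho>"
      using d(2) unfolding sem.simps(2) apply_set_def by blast
  qed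
  ultimately show ?thesis by blast
qed

text \<open>Comparing denotations in all environments at once makes the relation compatible with
  abstraction.\<close>

lemma lambda_theory_sem: "lambda_theory {(M, N). sem M = sem N}"
  unfolding lambda_theory_def
proof (intro conjI)
  show "equiv UNIV {(M, N). sem M = sem N}"
    by (auto simp: equiv_def refl_on_def sym_def trans_def)
  have "sem (Lam M \<degree> N) = sem (lsubst 0 N M)" for M N
    using sem_beta by (rule ext)
  then show "\<forall>M N. (Lam M \<degree> N, lsubst 0 N M) \<in> {(M, N). sem M = sem N}"
    by blast
qed (simp_all add: fun_eq_iff)

lemma sem_Delta: "d \<in> sem \<Delta> \<rho> \<longleftrightarrow> target d \<in> apply_set (source d) (source d)"
  by (simp add: Delta_def)

text \<open>An arrow \<open>d\<close> that witnesses membership in \<open>\<Delta>\<Delta>\<close> yields a witness inside its own source. The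
  source of an \<open>Arr\<close> consists of smaller points, so the descent ends at an \<open>EpsL\<close> or \<open>EpsR\<close>.\<close>

lemma target_Delta_Delta:
  assumes "d \<in> sem \<Delta> \<rho>" "source d \<subseteq> sem \<Delta> \<rho>"
  shows "target d \<in> range keepL \<union> range keepR"
  using assms
proof (induction d)
  case Atom
  then show ?case by (simp add: sem_Delta apply_set_def)
next
  case (Arr a \<alpha>)
  from Arr.prems(1) obtain e where e: "e \<in> fset a" "source e \<subseteq> fset a" "target e = \<alpha>"
    by (auto simp: sem_Delta apply_set_def)
  with Arr.prems(2) have "e \<in> sem \<Delta> \<rho>" "source e \<subseteq> sem \<Delta> \<rho>" by auto
  with Arr.IH(1)[OF e(1)] e(3) show ?case by simp
qed auto

lemma sem_Delta_Delta: "sem (\<Delta> \<degree> \<Delta>) \<rho> = range keepL \<union> range keepR"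
proof
  show "sem (\<Delta> \<degree> \<Delta>) \<rho> \<subseteq> range keepL \<union> range keepR"
    using target_Delta_Delta by (fastforce simp: apply_set_def)
next
  \<comment> \<open>A point that is its own only source witnesses both its membership in
    \<open>sem \<Delta> \<rho>\<close> and that of its target in the self-application.\<close>
  have "target d \<in> sem (\<Delta> \<degree> \<Delta>) \<rho>" if "source d = {d}" for d
  proof -
    have "d \<in> sem \<Delta> \<rho>" using that by (auto simp: sem_Delta apply_set_def)
    then show ?thesis using that by (auto simp: apply_set_def)
  qed
  from this[of "EpsL _"] this[of "EpsR _"]
  show "range keepL \<union> range keepR \<subseteq> sem (\<Delta> \<degree> \<Delta>) \<rho>" by auto
qed

lemma apply_set_Un: "apply_set (u \<union> v) w = apply_set u w \<union> apply_set v w"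
  by (auto simp: apply_set_def)

text \<open>After the first argument, \<open>keepL\<close> leaves {} \<rightarrow> \<alpha> for
  \<alpha> in \<open>u\<close>, which ignores \<open>v\<close> and returns \<open>u\<close>;
  \<open>keepR\<close> leaves every {\<alpha>} \<rightarrow> \<alpha>, which acts as the identity on
  \<open>v\<close>.\<close>

lemma apply_keep_union: "apply_set (apply_set (range keepL \<union> range keepR) u) v = u \<union> v"
proof -
  have "apply_set (range keepL \<union> range keepR) u = Arr {||} ` u \<union> range (\<lambda>\<alpha>. Arr {|\<alpha>|} \<alpha>)"
    by (force simp: apply_set_def keepL_def keepR_def)
  moreover have "apply_set (Arr {||} ` u) v = u"
    by (force simp: apply_set_def)
  moreover have "apply_set (range (\<lambda>\<alpha>. Arr {|\<alpha>|} \<alpha>)) v = v"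
    by (force simp: apply_set_def)
  ultimately show ?thesis by (simp add: apply_set_Un)
qed

lemma sem_Delta_Delta_union: "sem (\<Delta> \<degree> \<Delta> \<degree> M \<degree> N) \<rho> = sem M \<rho> \<union> sem N \<rho>"
  using sem_Delta_Delta apply_keep_union by (metis sem.simps(2))

theorem theorem4p2: "consistent J"
proof -
  have "J_axioms \<subseteq> {(M, N). sem M = sem N}"
    unfolding J_axioms_def
    by (auto simp: fun_eq_iff sem_Delta_Delta_union simp del: sem.simps(2))
  then have "J \<subseteq> {(M, N). sem M = sem N}"
    unfolding J_def using lambda_theory_sem by (rule theory_axiomatized_by_least[rotated])
  \<comment> \<open>Sending one variable to {} and the others to all points separates two
    variables.\<close>
  moreover have "sem (Var 0) (case_nat {} (\<lambda>_. UNIV)) \<noteq> sem (Var 1) (case_nat {} (\<lambda>_. UNIV))"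
    by simp
  ultimately have "(Var 0, Var 1) \<notin> J" by (metis (mono_tags, lifting) CollectD case_prodD subsetD)
  then show ?thesis unfolding consistent_def by blast
qed

end
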